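(* Let $0<\alpha<1$, $T>0$, and let $\lambda_1\ge 0$ and $\lambda_2\ge 0$ be constants. Then there exists a positive constant $\tau^*$ such that, whenever $\tau=T/N\le\tau^*$ ($N$ a positive integer) and the nonnegative sequences $\{\omega^n,g^n \mid n=0,1,2,\dots\}$ satisfy $$ D_\tau^\alpha\omega^n\le\lambda_1\omega^n+\lambda_2\omega^{n-1}+g^n,\qquad n\ge1, $$ one has $$ \omega^n\le 2\Big(\omega^0+\frac{t_n^\alpha}{\Gamma(1+\alpha)}\max_{0\le j\le n}g^j\Big)E_\alpha(2\lambda t_n^\alpha),\qquad 1\le n\le N, $$ where $E_\alpha(z)=\sum_{k=0}^\infty\frac{z^k}{\Gamma(1+k\alpha)}$ is the Mittag-Leffler function and $\lambda=\lambda_1+\frac{\lambda_2}{2-2^{1-\alpha}}$.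
   Context: $t_n=n\tau$ with time step $\tau=T/N$. The $L1$ approximation operator with step $\tau$ is $$D_\tau^\alpha\omega^n=\frac{\tau^{-\alpha}}{\Gamma(2-\alpha)}\sum_{j=1}^n a_{n-j}(\omega^j-\omega^{j-1}),\qquad n\ge1,\qquad a_i=(i+1)^{1-\alpha}-i^{1-\alpha}\ (i\ge0).$$ *)

theory Defs
  imports "HOL-Analysis.Analysis"
begin

definition L1_coeff :: "real \<Rightarrow> nat \<Rightarrow> real" where
  "L1_coeff \<alpha> i = real (i + 1) powr (1 - \<alpha>) - real i powr (1 - \<alpha>)"

(* The L1 approximation, with time step \<tau>, of the Caputo derivative of order \<alpha>; used for n \<ge> 1. *)
definition L1_op :: "real \<Rightarrow> real \<Rightarrow> (nat \<Rightarrow> real) \<Rightarrow> nat \<Rightarrow> real" where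
  "L1_op \<alpha> \<tau> \<omega> n =
     \<tau> powr (- \<alpha>) / Gamma (2 - \<alpha>) *
     (\<Sum>j = 1..n. L1_coeff \<alpha> (n - j) * (\<omega> j - \<omega> (j - 1)))"

(* The series converges for every real z when \<alpha> > 0. *)
definition mittag_leffler :: "real \<Rightarrow> real \<Rightarrow> real" where
  "mittag_leffler \<alpha> z = (\<Sum>k. z ^ k / Gamma (1 + real k * \<alpha>))"

end

theory Submission
  imports Defs
begin

text \<open>The L1 operator obeys a comparison principle: its coefficients are nonnegative and decrease
away from the diagonal, so a subsolution that starts below a supersolution stays below it as long
as the diagonal entry $\tau^{-\alpha}/\Gamma(2-\alpha)$ exceeds the coefficient of the implicit
term (\<open>L1_comparison\<close>). It therefore suffices to exhibit a supersolution of the size claimed.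

The supersolution is sampled from a continuous problem. Put $\mu = 2\lambda$ and
$u(t) = \sum_k \mu^k t^{(k+1)\alpha}/\Gamma(1+(k+1)\alpha)$, which solves $D^\alpha u = \mu u + 1$,
$u(0) = 0$, and satisfies $1 + \mu u(t) = E_\alpha(\mu t^\alpha)$. The central estimate is that the
L1 operator applied to the samples of $u$ is at least $E_\alpha(\mu t_{m-1}^\alpha)$ at the node
$t_m$ (\<open>L1_op_ml_response\<close>). It is proved term by term in the series: for
$v_k(t) = t^{k\alpha}/\Gamma(1+k\alpha)$ one has $D^\alpha v_{k+1} = v_k$, and L1 applied to
$v_{k+1}$ at $t_m$ is at least $v_k(t_{m-1})$ (\<open>L1_op_power\<close>). If the exponent
$(k+1)\alpha$ is at most 1, then $v_{k+1}$ is concave, and L1 even dominates the Caputo derivative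
at $t_m$ itself, by Chebyshev's integral inequality on each cell. If the exponent is at least 1,
then $v_{k+1}$ is convex and L1 may lie below the Caputo derivative at $t_m$, but shifting the
difference quotients by one cell shows that it dominates the one at $t_{m-1}$. This loss of one
step is the same for all $k$ and is recovered only once, after summation.

With $w = \omega^0$ and $G = \max_{0 \le j \le n} g^j$, the comparison function is
$2(w\,E_\alpha(\mu t^\alpha) + G\,u(t)) = 2w + (2\mu w + 2G)\,u(t)$. Replacing $t_{m-1}$ by $t_m$
costs only the increment of $E_\alpha(\mu t^\alpha)$ over one step, which is at most 1 for small
$\tau$ because this function is uniformly continuous on $[0,T]$; the factors 2 in the comparison
function and in $\mu = 2\lambda$ pay for it (\<open>supersolution_arith\<close>). The stated bound follows
from $u(t) \le t^\alpha/\Gamma(1+\alpha) \cdot E_\alpha(\mu t^\alpha)$, which holds because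
$\Gamma(1+x)\Gamma(1+y) \le \Gamma(1+x+y)$.\<close>

section \<open>The Gamma and Mittag-Leffler functions\<close>

text \<open>The function $x \mapsto \ln \Gamma(1+x)$ is convex and vanishes at 0, hence is superadditive on the
nonnegative reals.\<close>
lemma Gamma_superadditive:
  fixes x y :: real
  assumes "x \<ge> 0" "y \<ge> 0"
  shows "Gamma (1 + x) * Gamma (1 + y) \<le> Gamma (1 + (x + y))"
proof (cases "x + y = 0")
  case True
  then show ?thesis using assms by (auto simp: add_nonneg_eq_0_iff)
next
  case False
  define s where "s = x + y"
  have s: "s > 0" using False assms by (simp add: s_def)
  have *: "ln (Gamma (1 + u)) \<le> u / s * ln (Gamma (1 + s))" if "0 \<le> u" "u \<le> s" for u
  proof -
    have "(ln \<circ> Gamma) ((1 - u / s) *\<^sub>R 1 + (u / s) *\<^sub>R (1 + s))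
        \<le> (1 - u / s) * (ln \<circ> Gamma) 1 + (u / s) * (ln \<circ> Gamma) (1 + s :: real)"
      using that s by (intro convex_onD[OF log_convex_Gamma_real]) auto
    moreover have "(1 - u / s) *\<^sub>R 1 + (u / s) *\<^sub>R (1 + s) = 1 + u"
      using s by (simp add: field_simps)
    ultimately show ?thesis by (simp only: o_def) simp
  qed
  have "ln (Gamma (1 + x) * Gamma (1 + y)) = ln (Gamma (1 + x)) + ln (Gamma (1 + y))"
    using assms by (intro ln_mult_pos) (auto intro!: Gamma_real_pos)
  also have "\<dots> \<le> x / s * ln (Gamma (1 + s)) + y / s * ln (Gamma (1 + s))"
    using assms by (intro add_mono *) (auto simp: s_def)
  also have "\<dots> = ln (Gamma (1 + s))"
    using s by (simp add: s_def flip: distrib_right add_divide_distrib)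
  finally show ?thesis
    using assms s by (subst (asm) ln_le_cancel_iff) (auto simp: s_def intro!: Gamma_real_pos mult_pos_pos)
qed

text \<open>Half of Wendel's inequality: the point $y$ divides the unit interval from $y+\alpha-1$ to
$y+\alpha$ in the ratio $1-\alpha$ to $\alpha$, so log-convexity bounds $\Gamma(y)$ by the values
at the two ends, which differ by the factor $y+\alpha-1$. It serves as a ratio test for the
Mittag-Leffler series.\<close>
lemma Gamma_growth:
  fixes \<alpha> y :: real
  assumes "0 < \<alpha>" "\<alpha> < 1" "y + \<alpha> > 1"
  shows "Gamma y * (y + \<alpha> - 1) powr \<alpha> \<le> Gamma (y + \<alpha>)"
proof -
  define z where "z = y + \<alpha> - 1"
  have z: "z > 0" "y > 0" using assms by (auto simp: z_def)
  have Gz: "Gamma z > 0" "Gamma y > 0" "Gamma (z + 1) > 0" using z by auto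
  have G: "Gamma (z + 1) = z * Gamma z" using z by (intro Gamma_plus1) (auto elim!: nonpos_Ints_cases)
  have "(ln \<circ> Gamma) ((1 - (1 - \<alpha>)) *\<^sub>R z + (1 - \<alpha>) *\<^sub>R (z + 1))
      \<le> (1 - (1 - \<alpha>)) * (ln \<circ> Gamma) z + (1 - \<alpha>) * (ln \<circ> Gamma) (z + 1)"
    using assms z by (intro convex_onD[OF log_convex_Gamma_real]) auto
  moreover have "(1 - (1 - \<alpha>)) *\<^sub>R z + (1 - \<alpha>) *\<^sub>R (z + 1) = y"
    by (simp add: z_def algebra_simps)
  ultimately have "ln (Gamma y) \<le> \<alpha> * ln (Gamma z) + (1 - \<alpha>) * ln (Gamma (z + 1))" by simp
  also have "ln (Gamma z) = ln (Gamma (z + 1)) - ln z"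
    using z Gz unfolding G by (subst ln_mult_pos) auto
  finally have "ln (Gamma y * z powr \<alpha>) \<le> ln (Gamma (z + 1))"
    using z Gz by (subst ln_mult_pos) (auto simp: ln_powr algebra_simps)
  then show ?thesis
    using z Gz by (subst (asm) ln_le_cancel_iff) (auto simp: z_def)
qed

lemma summable_mittag_leffler:
  fixes \<alpha> z :: real
  assumes "0 < \<alpha>" "\<alpha> < 1"
  shows "summable (\<lambda>k. z ^ k / Gamma (1 + real k * \<alpha>))"
proof -
  have "filterlim (\<lambda>k. (real (Suc k) * \<alpha>) powr \<alpha>) at_top sequentially"
    using assms by real_asymp
  then have "\<forall>\<^sub>F k in sequentially. (real (Suc k) * \<alpha>) powr \<alpha> \<ge> 2 * \<bar>z\<bar>"
    by (simp add: filterlim_at_top)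
  then obtain K where K: "\<And>k. k \<ge> K \<Longrightarrow> (real (Suc k) * \<alpha>) powr \<alpha> \<ge> 2 * \<bar>z\<bar>"
    by (auto simp: eventually_sequentially)
  show ?thesis
  proof (rule summable_ratio_test[of "1/2" K])
    fix k assume "k \<ge> K"
    define G where "G = Gamma (1 + real k * \<alpha>)"
    define H where "H = Gamma (1 + real (Suc k) * \<alpha>)"
    have pos: "G > 0" "H > 0" unfolding G_def H_def
      using assms by (auto intro!: Gamma_real_pos add_pos_nonneg)
    have "G * (2 * \<bar>z\<bar>) \<le> G * (real (Suc k) * \<alpha>) powr \<alpha>"
      using K[OF \<open>k \<ge> K\<close>] pos by (intro mult_left_mono) auto
    also have "\<dots> \<le> H"
    proof -
      have "0 < (1 + real k) * \<alpha>" using assms by (intro mult_pos_pos) auto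
      then have "1 + real k * \<alpha> + \<alpha> > 1" by (simp add: algebra_simps)
      from Gamma_growth[OF assms this] show ?thesis
        by (simp add: G_def H_def algebra_simps)
    qed
    finally have "\<bar>z\<bar> / H \<le> 1 / (2 * G)" using pos by (simp add: field_simps)
    then have "\<bar>z\<bar> ^ k * (\<bar>z\<bar> / H) \<le> \<bar>z\<bar> ^ k * (1 / (2 * G))"
      by (intro mult_left_mono) auto
    then show "norm (z ^ Suc k / H) \<le> 1 / 2 * norm (z ^ k / G)"
      using pos by (simp add: abs_mult power_abs mult_ac)
  qed simp
qed

lemma continuous_mittag_leffler:
  fixes \<alpha> :: real
  assumes "0 < \<alpha>" "\<alpha> < 1"
  shows "continuous_on A (mittag_leffler \<alpha>)"
proof -
  have "isCont (\<lambda>z. \<Sum>k. inverse (Gamma (1 + real k * \<alpha>)) * z ^ k) z" for z :: real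
    using summable_mittag_leffler[OF assms]
    by (intro isCont_powser_converges_everywhere) (simp add: divide_inverse mult_ac)
  then have "isCont (mittag_leffler \<alpha>) z" for z
    unfolding mittag_leffler_def by (simp add: divide_inverse mult_ac)
  then show ?thesis by (simp add: continuous_at_imp_continuous_on)
qed

lemma Gamma_two_minus:
  fixes \<alpha> :: real
  assumes "\<alpha> < 1"
  shows "Gamma (2 - \<alpha>) = (1 - \<alpha>) * Gamma (1 - \<alpha>)"
proof -
  have "Gamma ((1 - \<alpha>) + 1) = (1 - \<alpha>) * Gamma (1 - \<alpha>)"
    using assms by (intro Gamma_plus1) (auto elim!: nonpos_Ints_cases)
  then show ?thesis by (simp add: algebra_simps)
qed

section \<open>Kernel and power integrals\<close>

lemma has_integral_kernel:
  fixes \<alpha> n p q :: real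
  assumes "\<alpha> < 1" "p \<le> q" "q \<le> n"
  shows "((\<lambda>s. (n - s) powr (- \<alpha>)) has_integral
           ((n - p) powr (1 - \<alpha>) - (n - q) powr (1 - \<alpha>)) / (1 - \<alpha>)) {p..q}"
proof -
  let ?F = "\<lambda>s. - ((n - s) powr (1 - \<alpha>)) / (1 - \<alpha>)"
  have "((\<lambda>s. (n - s) powr (- \<alpha>)) has_integral ?F q - ?F p) {p..q}"
  proof (intro fundamental_theorem_of_calculus_interior)
    show "continuous_on {p..q} ?F"
      using assms by (intro continuous_intros continuous_on_powr') auto
  next
    fix s assume "s \<in> {p<..<q}"
    then have "(?F has_real_derivative (n - s) powr (- \<alpha>)) (at s)"
      using assms by (auto intro!: derivative_eq_intros)
    then show "(?F has_vector_derivative (n - s) powr (- \<alpha>)) (at s)"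
      by (simp add: has_real_derivative_iff_has_vector_derivative)
  qed (use assms in auto)
  then show ?thesis by (simp add: diff_divide_distrib)
qed

lemma has_integral_powr_deriv:
  fixes \<beta> p q :: real
  assumes "\<beta> > 0" "0 \<le> p" "p \<le> q"
  shows "((\<lambda>s. \<beta> * s powr (\<beta> - 1)) has_integral q powr \<beta> - p powr \<beta>) {p..q}"
proof (intro fundamental_theorem_of_calculus_interior)
  show "continuous_on {p..q} (\<lambda>s. s powr \<beta>)"
    using assms by (intro continuous_intros continuous_on_powr') auto
next
  fix s assume "s \<in> {p<..<q}"
  then have "((\<lambda>s. s powr \<beta>) has_real_derivative \<beta> * s powr (\<beta> - 1)) (at s)"
    using assms by (auto intro!: derivative_eq_intros)
  then show "((\<lambda>s. s powr \<beta>) has_vector_derivative \<beta> * s powr (\<beta> - 1)) (at s)"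
    by (simp add: has_real_derivative_iff_has_vector_derivative)
qed (use assms in auto)

lemma powr_mvt:
  fixes \<beta> p q :: real
  assumes "\<beta> > 0" "0 \<le> p" "p < q"
  obtains \<xi> where "p < \<xi>" "\<xi> < q" "q powr \<beta> - p powr \<beta> = (q - p) * (\<beta> * \<xi> powr (\<beta> - 1))"
proof -
  have "\<exists>l z. p < z \<and> z < q \<and> ((\<lambda>s. s powr \<beta>) has_real_derivative l) (at z) \<and>
      q powr \<beta> - p powr \<beta> = (q - p) * l"
  proof (rule MVT)
    show "continuous_on {p..q} (\<lambda>s. s powr \<beta>)"
      using assms by (intro continuous_intros continuous_on_powr') auto
    show "(\<lambda>s. s powr \<beta>) differentiable (at x)" if "p < x" "x < q" for x
    proof -
      have "((\<lambda>s. s powr \<beta>) has_real_derivative \<beta> * x powr (\<beta> - 1)) (at x)"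
        using that assms by (auto intro!: derivative_eq_intros)
      then show ?thesis by (meson real_differentiable_def)
    qed
  qed fact
  then obtain l z where z: "p < z" "z < q" "((\<lambda>s. s powr \<beta>) has_real_derivative l) (at z)"
      "q powr \<beta> - p powr \<beta> = (q - p) * l" by blast
  have "((\<lambda>s. s powr \<beta>) has_real_derivative \<beta> * z powr (\<beta> - 1)) (at z)"
    using z assms by (auto intro!: derivative_eq_intros)
  with z(3) have "l = \<beta> * z powr (\<beta> - 1)" by (rule DERIV_unique)
  with z that show ?thesis by blast
qed

text \<open>Chebyshev's integral inequality for oppositely ordered functions, in a form where the mean of $g$
is attained at a known point $\xi$. Integrating the hypothesis \<open>opposite\<close> is enough: the term
$f(\xi)(g - g(\xi))$ integrates to zero. Only interior points are compared, which leaves room for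
integrands that are singular at an endpoint.\<close>
lemma chebyshev_integral_le:
  fixes f g :: "real \<Rightarrow> real"
  assumes f: "(f has_integral F) {p..q}"
    and g: "(g has_integral (q - p) * g \<xi>) {p..q}"
    and fg: "((\<lambda>s. f s * g s) has_integral I) {p..q}"
    and "p \<le> q"
    and opposite: "\<And>s. p < s \<Longrightarrow> s < q \<Longrightarrow> (f s - f \<xi>) * (g s - g \<xi>) \<le> 0"
  shows "I \<le> F * g \<xi>"
proof -
  have "((\<lambda>s. f s * g \<xi> + f \<xi> * (g s - g \<xi>)) has_integral
          F * g \<xi> + f \<xi> * ((q - p) * g \<xi> - (q - p) * g \<xi>)) {p..q}"
    using f g has_integral_const_real[of "g \<xi>" p q] \<open>p \<le> q\<close>
    by (intro has_integral_add has_integral_mult_left has_integral_mult_right has_integral_diff) auto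
  then have upper: "((\<lambda>s. f s * g \<xi> + f \<xi> * (g s - g \<xi>)) has_integral F * g \<xi>) {p<..<q}"
    by (simp add: has_integral_Icc_iff_Ioo)
  have fg': "((\<lambda>s. f s * g s) has_integral I) {p<..<q}"
    using fg by (simp add: has_integral_Icc_iff_Ioo)
  show ?thesis
  proof (rule has_integral_le[OF fg' upper])
    fix s assume "s \<in> {p<..<q}"
    moreover have "(f s - f \<xi>) * (g s - g \<xi>) = f s * g s - (f s * g \<xi> + f \<xi> * (g s - g \<xi>))"
      by (simp add: algebra_simps)
    ultimately show "f s * g s \<le> f s * g \<xi> + f \<xi> * (g s - g \<xi>)"
      using opposite[of s] by simp
  qed
qed

text \<open>For $\beta \le 1$ the slope $\beta s^{\beta-1}$ decreases while the kernel $(n-s)^{-\alpha}$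
increases, so replacing the slope by its mean over the cell, which is the difference quotient used
by L1, can only increase the integral.\<close>
lemma caputo_integrand_cell_concave:
  fixes \<alpha> \<beta> n p q :: real
  assumes "0 < \<alpha>" "\<alpha> < 1" "0 < \<beta>" "\<beta> \<le> 1" "0 \<le> p" "p < q" "q \<le> n"
    and I: "((\<lambda>s. (n - s) powr (- \<alpha>) * (\<beta> * s powr (\<beta> - 1))) has_integral I) {p..q}"
  shows "I \<le> ((n - p) powr (1 - \<alpha>) - (n - q) powr (1 - \<alpha>)) / (1 - \<alpha>) * ((q powr \<beta> - p powr \<beta>) / (q - p))"
proof -
  obtain \<xi> where \<xi>: "p < \<xi>" "\<xi> < q" "q powr \<beta> - p powr \<beta> = (q - p) * (\<beta> * \<xi> powr (\<beta> - 1))"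
    by (rule powr_mvt[of \<beta> p q]) (use assms in auto)
  have kernel_mono: "(n - a) powr (- \<alpha>) \<le> (n - b) powr (- \<alpha>)" if "a \<le> b" "b < n" for a b
    using that assms by (intro powr_mono2') auto
  have slope_anti: "\<beta> * b powr (\<beta> - 1) \<le> \<beta> * a powr (\<beta> - 1)" if "0 < a" "a \<le> b" for a b
    using that assms by (intro mult_left_mono powr_mono2') auto
  have "I \<le> ((n - p) powr (1 - \<alpha>) - (n - q) powr (1 - \<alpha>)) / (1 - \<alpha>) * (\<beta> * \<xi> powr (\<beta> - 1))"
  proof (rule chebyshev_integral_le[OF has_integral_kernel _ I, where \<xi> = \<xi>])
    show "((\<lambda>s. \<beta> * s powr (\<beta> - 1)) has_integral (q - p) * (\<beta> * \<xi> powr (\<beta> - 1))) {p..q}"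
      using has_integral_powr_deriv[of \<beta> p q] assms by (simp flip: \<xi>(3))
    fix s assume s: "p < s" "s < q"
    show "((n - s) powr (- \<alpha>) - (n - \<xi>) powr (- \<alpha>)) * (\<beta> * s powr (\<beta> - 1) - \<beta> * \<xi> powr (\<beta> - 1)) \<le> 0"
    proof (cases "s \<le> \<xi>")
      case True
      then show ?thesis
        using kernel_mono[of s \<xi>] slope_anti[of s \<xi>] s \<xi> assms by (intro mult_nonpos_nonneg) auto
    next
      case False
      then show ?thesis
        using kernel_mono[of \<xi> s] slope_anti[of \<xi> s] s \<xi> assms by (intro mult_nonneg_nonpos) auto
    qed
  qed (use assms in auto)
  then show ?thesis using \<xi>(3) assms by simp
qed

text \<open>For $\beta \ge 1$ the slope increases, so on the cell it stays below the difference quotient over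
any interval that starts at the right end of the cell.\<close>
lemma caputo_integrand_cell_convex:
  fixes \<alpha> \<beta> n p q :: real
  assumes "\<alpha> < 1" "1 \<le> \<beta>" "0 \<le> p" "p \<le> q" "q \<le> n" "q < r"
    and I: "((\<lambda>s. (n - s) powr (- \<alpha>) * (\<beta> * s powr (\<beta> - 1))) has_integral I) {p..q}"
  shows "I \<le> ((n - p) powr (1 - \<alpha>) - (n - q) powr (1 - \<alpha>)) / (1 - \<alpha>) * ((r powr \<beta> - q powr \<beta>) / (r - q))"
proof -
  obtain \<xi> where \<xi>: "q < \<xi>" "\<xi> < r" "r powr \<beta> - q powr \<beta> = (r - q) * (\<beta> * \<xi> powr (\<beta> - 1))"
    by (rule powr_mvt[of \<beta> q r]) (use assms in auto)
  have "I \<le> ((n - p) powr (1 - \<alpha>) - (n - q) powr (1 - \<alpha>)) / (1 - \<alpha>) * (\<beta> * \<xi> powr (\<beta> - 1))"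
  proof (rule has_integral_le[OF I has_integral_mult_left[OF has_integral_kernel]])
    fix s assume "s \<in> {p..q}"
    then show "(n - s) powr (- \<alpha>) * (\<beta> * s powr (\<beta> - 1)) \<le> (n - s) powr (- \<alpha>) * (\<beta> * \<xi> powr (\<beta> - 1))"
      using assms \<xi> by (intro mult_left_mono powr_mono2) auto
  qed (use assms in auto)
  then show ?thesis using \<xi>(3) assms by simp
qed

text \<open>Up to the factor $1/\Gamma(1-\alpha)$ this is the Caputo derivative of $t^\beta$ at $t = n$: the
Beta integral rescaled from $[0,1]$ to $[0,n]$.\<close>
lemma caputo_power:
  fixes \<alpha> \<beta> n :: real
  assumes "\<alpha> < 1" "0 < \<beta>" "0 < n"
  shows "((\<lambda>s. (n - s) powr (- \<alpha>) * (\<beta> * s powr (\<beta> - 1))) has_integral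
           n powr (\<beta> - \<alpha>) * (Gamma (1 - \<alpha>) * Gamma (1 + \<beta>) / Gamma (1 + \<beta> - \<alpha>))) {0..n}"
proof -
  have "((\<lambda>t. t powr (\<beta> - 1) * (1 - t) powr ((1 - \<alpha>) - 1)) has_integral Beta \<beta> (1 - \<alpha>)) {0..1}"
    using assms by (intro has_integral_Beta_real) auto
  from has_integral_stretch_real[OF this, of "1 / n"]
  have *: "((\<lambda>s. (s / n) powr (\<beta> - 1) * (1 - s / n) powr (- \<alpha>)) has_integral n * Beta \<beta> (1 - \<alpha>))
      ((\<lambda>x. x * n) ` {0..1})"
    using assms by simp
  have "(\<lambda>x. x * n) ` {0..1} = {0..n}"
    using assms by (simp add: image_mult_atLeastAtMost mult.commute[of _ n])
  note * = *[unfolded this]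
  have "((\<lambda>s. (n powr (- \<alpha>) * n powr (\<beta> - 1) * \<beta>) * ((s / n) powr (\<beta> - 1) * (1 - s / n) powr (- \<alpha>)))
      has_integral (n powr (- \<alpha>) * n powr (\<beta> - 1) * \<beta>) * (n * Beta \<beta> (1 - \<alpha>))) {0..n}"
    by (rule has_integral_mult_right[OF *])
  also have "(n powr (- \<alpha>) * n powr (\<beta> - 1) * \<beta>) * (n * Beta \<beta> (1 - \<alpha>)) =
      (n powr (- \<alpha>) * n powr (\<beta> - 1) * n powr 1) * (\<beta> * Beta \<beta> (1 - \<alpha>))"
    using assms by simp
  also have "n powr (- \<alpha>) * n powr (\<beta> - 1) * n powr 1 = n powr (\<beta> - \<alpha>)"
    by (simp only: powr_add[symmetric]) simp
  also have "\<beta> * Beta \<beta> (1 - \<alpha>) = Gamma (1 - \<alpha>) * Gamma (1 + \<beta>) / Gamma (1 + \<beta> - \<alpha>)"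
  proof -
    have "Gamma (\<beta> + 1) = \<beta> * Gamma \<beta>"
      using assms by (intro Gamma_plus1) (auto elim!: nonpos_Ints_cases)
    moreover have "\<beta> + 1 = 1 + \<beta>" "\<beta> + (1 - \<alpha>) = 1 + \<beta> - \<alpha>" by simp_all
    ultimately show ?thesis by (simp only: Beta_def times_divide_eq_right mult_ac)
  qed
  finally show ?thesis
  proof (rule has_integral_eq[rotated])
    fix s assume "s \<in> {0..n}"
    then have s: "0 \<le> s" "s \<le> n" by auto
    have k: "n powr (- \<alpha>) * (1 - s / n) powr (- \<alpha>) = (n - s) powr (- \<alpha>)"
    proof -
      have "n * (1 - s / n) = n - s" using assms by (simp add: right_diff_distrib)
      then show ?thesis by (metis powr_mult)
    qed
    have d: "n powr (\<beta> - 1) * (s / n) powr (\<beta> - 1) = s powr (\<beta> - 1)"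
    proof -
      have "n * (s / n) = s" using assms by simp
      then show ?thesis by (metis powr_mult)
    qed
    have "(n powr (- \<alpha>) * n powr (\<beta> - 1) * \<beta>) * ((s / n) powr (\<beta> - 1) * (1 - s / n) powr (- \<alpha>)) =
        (n powr (- \<alpha>) * (1 - s / n) powr (- \<alpha>)) * (\<beta> * (n powr (\<beta> - 1) * (s / n) powr (\<beta> - 1)))"
      by (simp only: mult_ac)
    then show "(n powr (- \<alpha>) * n powr (\<beta> - 1) * \<beta>) * ((s / n) powr (\<beta> - 1) * (1 - s / n) powr (- \<alpha>)) =
        (n - s) powr (- \<alpha>) * (\<beta> * s powr (\<beta> - 1))"
      by (simp only: k d)
  qed
qed

lemma integral_unit_cells:
  fixes f :: "real \<Rightarrow> real"
  assumes "f integrable_on {0..real n}"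
  shows "integral {0..real n} f = (\<Sum>j = 1..n. integral {real (j - 1)..real j} f)"
  using assms
proof (induction n)
  case (Suc n)
  have "f integrable_on {0..real n}"
    by (rule integrable_subinterval_real[OF Suc.prems]) auto
  then have "(\<Sum>j = 1..Suc n. integral {real (j - 1)..real j} f) =
      integral {0..real n} f + integral {real n..real (Suc n)} f"
    using Suc.IH by simp
  also have "\<dots> = integral {0..real (Suc n)} f"
    using Suc.prems by (intro Henstock_Kurzweil_Integration.integral_combine) auto
  finally show ?case by simp
qed simp

section \<open>The comparison principle for the L1 operator\<close>

lemma L1_coeff_nonneg: "\<alpha> < 1 \<Longrightarrow> 0 \<le> L1_coeff \<alpha> i"
  by (auto simp: L1_coeff_def intro!: powr_mono2)

lemma L1_coeff_antimono:
  assumes "0 < \<alpha>" "\<alpha> < 1"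
  shows "antimono (L1_coeff \<alpha>)"
proof (rule decseq_SucI)
  fix i :: nat
  obtain \<xi> where \<xi>: "real i < \<xi>" "\<xi> < real (i + 1)"
      "real (i + 1) powr (1 - \<alpha>) - real i powr (1 - \<alpha>) = (real (i + 1) - real i) * ((1 - \<alpha>) * \<xi> powr (1 - \<alpha> - 1))"
    by (rule powr_mvt[of "1 - \<alpha>" "real i" "real (i + 1)"]) (use assms in auto)
  obtain \<eta> where \<eta>: "real (i + 1) < \<eta>" "\<eta> < real (i + 2)"
      "real (i + 2) powr (1 - \<alpha>) - real (i + 1) powr (1 - \<alpha>) = (real (i + 2) - real (i + 1)) * ((1 - \<alpha>) * \<eta> powr (1 - \<alpha> - 1))"
    by (rule powr_mvt[of "1 - \<alpha>" "real (i + 1)" "real (i + 2)"]) (use assms in auto)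
  have "\<eta> powr (1 - \<alpha> - 1) \<le> \<xi> powr (1 - \<alpha> - 1)"
    using \<xi> \<eta> assms by (intro powr_mono2') auto
  then have "(1 - \<alpha>) * \<eta> powr (1 - \<alpha> - 1) \<le> (1 - \<alpha>) * \<xi> powr (1 - \<alpha> - 1)"
    using assms by (intro mult_left_mono) auto
  then show "L1_coeff \<alpha> (Suc i) \<le> L1_coeff \<alpha> i"
    using \<xi>(3) \<eta>(3) by (simp add: L1_coeff_def add_ac)
qed

text \<open>Summation by parts gives every earlier value of $x$ a nonpositive coefficient, so nonpositive
earlier values can only help. The induction removes the last increment and shifts the
kernel by one place.\<close>
lemma kernel_sum_ge_of_nonpos:
  fixes b x :: "nat \<Rightarrow> real"
  assumes "antimono b" "\<And>i. b i \<ge> 0" "\<And>j. j < m \<Longrightarrow> x j \<le> 0" "m \<ge> 1"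
  shows "b 0 * x m \<le> (\<Sum>j = 1..m. b (m - j) * (x j - x (j - 1)))"
  using assms
proof (induction m arbitrary: b)
  case (Suc m)
  show ?case
  proof (cases "m = 0")
    case True
    have "b 0 * x 0 \<le> 0" using Suc.prems(3)[of 0] Suc.prems(2)[of 0] by (auto intro: mult_nonneg_nonpos)
    then show ?thesis using True by (simp add: algebra_simps)
  next
    case False
    let ?b = "\<lambda>i. b (Suc i)"
    have "b 0 * x m \<le> ?b 0 * x m"
      using Suc.prems(1) Suc.prems(3)[of m] by (intro mult_right_mono_neg) (auto simp: antimono_def)
    also have "\<dots> \<le> (\<Sum>j = 1..m. ?b (m - j) * (x j - x (j - 1)))"
      using Suc.prems False by (intro Suc.IH) (auto simp: antimono_def)
    also have "\<dots> = (\<Sum>j = 1..m. b (Suc m - j) * (x j - x (j - 1)))"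
      by (intro sum.cong) (auto simp: Suc_diff_le)
    finally show ?thesis by (simp add: algebra_simps)
  qed
qed simp

lemma L1_op_ge_of_nonpos:
  assumes "0 < \<alpha>" "\<alpha> < 1" "m \<ge> 1" "\<And>j. j < m \<Longrightarrow> x j \<le> 0"
  shows "\<tau> powr (- \<alpha>) / Gamma (2 - \<alpha>) * x m \<le> L1_op \<alpha> \<tau> x m"
proof -
  have "L1_coeff \<alpha> 0 * x m \<le> (\<Sum>j = 1..m. L1_coeff \<alpha> (m - j) * (x j - x (j - 1)))"
    using assms by (intro kernel_sum_ge_of_nonpos L1_coeff_antimono L1_coeff_nonneg) auto
  moreover have "L1_coeff \<alpha> 0 = 1" by (simp add: L1_coeff_def)
  moreover have "Gamma (2 - \<alpha>) > 0" using assms by auto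
  ultimately show ?thesis unfolding L1_op_def by (intro mult_left_mono) auto
qed

lemma L1_op_diff: "L1_op \<alpha> \<tau> (\<lambda>j. x j - y j) m = L1_op \<alpha> \<tau> x m - L1_op \<alpha> \<tau> y m"
  unfolding L1_op_def right_diff_distrib[symmetric] sum_subtractf[symmetric]
  by (simp add: algebra_simps)

lemma L1_op_affine: "L1_op \<alpha> \<tau> (\<lambda>j. c + d * x j) m = d * L1_op \<alpha> \<tau> x m"
proof -
  have "(\<Sum>j = 1..m. L1_coeff \<alpha> (m - j) * ((c + d * x j) - (c + d * x (j - 1)))) =
      d * (\<Sum>j = 1..m. L1_coeff \<alpha> (m - j) * (x j - x (j - 1)))"
    unfolding sum_distrib_left by (intro sum.cong) (auto simp: algebra_simps)
  then show ?thesis by (simp add: L1_op_def)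
qed

text \<open>At the first node where $x - y$ could become positive, the operator applied to it is at least the
diagonal coefficient times $x - y$; as this coefficient exceeds \<open>lam1\<close>, the two difference
inequalities force $x - y$ to be nonpositive there as well.\<close>
lemma L1_comparison:
  assumes \<alpha>: "0 < \<alpha>" "\<alpha> < 1"
    and step: "lam1 < \<tau> powr (- \<alpha>) / Gamma (2 - \<alpha>)" and "lam2 \<ge> 0"
    and init: "x 0 \<le> y 0"
    and sub: "\<And>m. 1 \<le> m \<Longrightarrow> m \<le> n \<Longrightarrow> L1_op \<alpha> \<tau> x m \<le> lam1 * x m + lam2 * x (m - 1) + h m"
    and super: "\<And>m. 1 \<le> m \<Longrightarrow> m \<le> n \<Longrightarrow> lam1 * y m + lam2 * y (m - 1) + h m \<le> L1_op \<alpha> \<tau> y m"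
  shows "x n \<le> y n"
proof -
  have "m \<le> n \<longrightarrow> x m - y m \<le> 0" for m
  proof (induction m rule: less_induct)
    case (less m)
    show ?case
    proof (cases "1 \<le> m \<and> m \<le> n")
      case True
      let ?\<kappa> = "\<tau> powr (- \<alpha>) / Gamma (2 - \<alpha>)"
      have "?\<kappa> * (x m - y m) \<le> L1_op \<alpha> \<tau> (\<lambda>j. x j - y j) m"
        using less True \<alpha> by (intro L1_op_ge_of_nonpos) auto
      also have "\<dots> \<le> lam1 * (x m - y m) + lam2 * (x (m - 1) - y (m - 1))"
        using sub[of m] super[of m] True by (simp add: L1_op_diff algebra_simps)
      also have "\<dots> \<le> lam1 * (x m - y m)"
        using less[of "m - 1"] True \<open>lam2 \<ge> 0\<close> by (auto intro: mult_nonneg_nonpos)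
      finally have "(?\<kappa> - lam1) * (x m - y m) \<le> 0" by (simp add: algebra_simps)
      then show ?thesis using step by (auto simp: mult_le_0_iff)
    next
      case False
      then have "m = 0 \<or> \<not> m \<le> n" by auto
      then show ?thesis using init by auto
    qed
  qed
  then show ?thesis by simp
qed

section \<open>The L1 operator on powers\<close>

text \<open>The weight of a cell in the L1 sum is $1-\alpha$ times the integral of the kernel over it, so the cell
estimates add up to the Caputo integral over $[0,m]$.\<close>
lemma L1_sum_power_concave:
  fixes \<alpha> \<beta> :: real
  assumes "0 < \<alpha>" "\<alpha> < 1" "0 < \<beta>" "\<beta> \<le> 1" "m \<ge> 1"
  shows "real m powr (\<beta> - \<alpha>) * (Gamma (2 - \<alpha>) * Gamma (1 + \<beta>) / Gamma (1 + \<beta> - \<alpha>))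
      \<le> (\<Sum>j = 1..m. L1_coeff \<alpha> (m - j) * (real j powr \<beta> - real (j - 1) powr \<beta>))"
proof -
  let ?f = "\<lambda>s. (real m - s) powr (- \<alpha>) * (\<beta> * s powr (\<beta> - 1))"
  let ?C = "Gamma (1 - \<alpha>) * Gamma (1 + \<beta>) / Gamma (1 + \<beta> - \<alpha>)"
  have I: "(?f has_integral real m powr (\<beta> - \<alpha>) * ?C) {0..real m}"
    using assms by (intro caputo_power) auto
  then have "real m powr (\<beta> - \<alpha>) * ?C = (\<Sum>j = 1..m. integral {real (j - 1)..real j} ?f)"
    using integral_unit_cells[of ?f m] by (simp add: integral_unique has_integral_integrable)
  also have "\<dots> \<le> (\<Sum>j = 1..m. L1_coeff \<alpha> (m - j) / (1 - \<alpha>) * (real j powr \<beta> - real (j - 1) powr \<beta>))"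
  proof (rule sum_mono)
    fix j assume j: "j \<in> {1..m}"
    have "?f integrable_on {real (j - 1)..real j}"
      using j by (intro integrable_subinterval_real[OF has_integral_integrable[OF I]]) auto
    then have "(?f has_integral integral {real (j - 1)..real j} ?f) {real (j - 1)..real j}"
      by (rule integrable_integral)
    then have "integral {real (j - 1)..real j} ?f \<le>
        ((real m - real (j - 1)) powr (1 - \<alpha>) - (real m - real j) powr (1 - \<alpha>)) / (1 - \<alpha>) *
        ((real j powr \<beta> - real (j - 1) powr \<beta>) / (real j - real (j - 1)))"
      by (rule caputo_integrand_cell_concave[rotated -1]) (use assms j in auto)
    moreover have "real m - real (j - 1) = real (m - j + 1)" "real m - real j = real (m - j)"
        "real j - real (j - 1) = 1"
      using j by (auto simp: of_nat_diff)
    ultimately show "integral {real (j - 1)..real j} ?f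
        \<le> L1_coeff \<alpha> (m - j) / (1 - \<alpha>) * (real j powr \<beta> - real (j - 1) powr \<beta>)"
      by (simp only: L1_coeff_def div_by_1)
  qed
  finally have "real m powr (\<beta> - \<alpha>) * ?C
      \<le> (\<Sum>j = 1..m. L1_coeff \<alpha> (m - j) * (real j powr \<beta> - real (j - 1) powr \<beta>)) / (1 - \<alpha>)"
    by (simp add: sum_divide_distrib)
  then show ?thesis
    using assms by (simp add: Gamma_two_minus pos_le_divide_eq mult_ac)
qed

text \<open>The difference quotient of the cell that ends at $j+1$ carries the weight of the cell that
ends at $j$ in the kernel centred at $m-1$. Hence the sum dominates, cell by cell, the Caputo
integral over $[0,m-1]$; the first increment is left over and is nonnegative.\<close>
lemma L1_sum_power_convex:
  fixes \<alpha> \<beta> :: real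
  assumes "0 < \<alpha>" "\<alpha> < 1" "1 \<le> \<beta>" "m \<ge> 1"
  shows "real (m - 1) powr (\<beta> - \<alpha>) * (Gamma (2 - \<alpha>) * Gamma (1 + \<beta>) / Gamma (1 + \<beta> - \<alpha>))
      \<le> (\<Sum>j = 1..m. L1_coeff \<alpha> (m - j) * (real j powr \<beta> - real (j - 1) powr \<beta>))"
proof -
  obtain n where m: "m = Suc n" using assms by (cases m) auto
  let ?f = "\<lambda>s. (real n - s) powr (- \<alpha>) * (\<beta> * s powr (\<beta> - 1))"
  let ?C = "Gamma (1 - \<alpha>) * Gamma (1 + \<beta>) / Gamma (1 + \<beta> - \<alpha>)"
  let ?S = "\<Sum>j = 1..n. L1_coeff \<alpha> (n - j) * (real (Suc j) powr \<beta> - real j powr \<beta>)"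
  have "(\<Sum>j = Suc 1..Suc n. L1_coeff \<alpha> (m - j) * (real j powr \<beta> - real (j - 1) powr \<beta>)) = ?S"
    unfolding m by (subst sum.shift_bounds_cl_Suc_ivl) simp
  then have "(\<Sum>j = 1..m. L1_coeff \<alpha> (m - j) * (real j powr \<beta> - real (j - 1) powr \<beta>)) = L1_coeff \<alpha> n + ?S"
    using assms unfolding m by (subst sum.atLeast_Suc_atMost) auto
  with L1_coeff_nonneg[of \<alpha> n] assms
  have S: "?S \<le> (\<Sum>j = 1..m. L1_coeff \<alpha> (m - j) * (real j powr \<beta> - real (j - 1) powr \<beta>))"
    by linarith
  have "real n powr (\<beta> - \<alpha>) * ?C \<le> ?S / (1 - \<alpha>)"
  proof (cases "n = 0")
    case False
    have I: "(?f has_integral real n powr (\<beta> - \<alpha>) * ?C) {0..real n}"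
      using assms False by (intro caputo_power) auto
    then have "real n powr (\<beta> - \<alpha>) * ?C = (\<Sum>j = 1..n. integral {real (j - 1)..real j} ?f)"
      using integral_unit_cells[of ?f n] by (simp add: integral_unique has_integral_integrable)
    also have "\<dots> \<le> (\<Sum>j = 1..n. L1_coeff \<alpha> (n - j) / (1 - \<alpha>) * (real (Suc j) powr \<beta> - real j powr \<beta>))"
    proof (rule sum_mono)
      fix j assume j: "j \<in> {1..n}"
      have "?f integrable_on {real (j - 1)..real j}"
        using j by (intro integrable_subinterval_real[OF has_integral_integrable[OF I]]) auto
      then have "(?f has_integral integral {real (j - 1)..real j} ?f) {real (j - 1)..real j}"
        by (rule integrable_integral)
      then have "integral {real (j - 1)..real j} ?f \<le>
          ((real n - real (j - 1)) powr (1 - \<alpha>) - (real n - real j) powr (1 - \<alpha>)) / (1 - \<alpha>) *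
          ((real (Suc j) powr \<beta> - real j powr \<beta>) / (real (Suc j) - real j))"
        by (rule caputo_integrand_cell_convex[rotated -1]) (use assms j in auto)
      moreover have "real n - real (j - 1) = real (n - j + 1)" "real n - real j = real (n - j)"
          "real (Suc j) - real j = 1"
        using j by (auto simp: of_nat_diff)
      ultimately show "integral {real (j - 1)..real j} ?f
          \<le> L1_coeff \<alpha> (n - j) / (1 - \<alpha>) * (real (Suc j) powr \<beta> - real j powr \<beta>)"
        by (simp only: L1_coeff_def div_by_1)
    qed
    finally show ?thesis by (simp add: sum_divide_distrib)
  qed simp
  then have "real n powr (\<beta> - \<alpha>) * (Gamma (2 - \<alpha>) * Gamma (1 + \<beta>) / Gamma (1 + \<beta> - \<alpha>)) \<le> ?S"
    using assms by (simp add: Gamma_two_minus pos_le_divide_eq mult_ac)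
  with S show ?thesis unfolding m by simp
qed

lemma powr_power_nonneg:
  fixes x a :: real
  assumes "x > 0 \<or> k \<ge> 1"
  shows "(x powr a) ^ k = x powr (real k * a)"
  using assms by (cases "x = 0") (auto simp: powr_power mult.commute power_0_left)

text \<open>L1 reproduces the rule $D^\alpha v_{k+1} = v_k$ for $v_k(t) = t^{k\alpha}/\Gamma(1+k\alpha)$ as an
inequality with a lag of one step. The lag is what makes one statement valid for
concave and convex powers alike. The powers are written as $(t^\alpha)^k$ because this is 1
for $k = 0$ and $t = 0$, whereas \<^term>\<open>0 powr (0::real)\<close> is 0.\<close>
lemma L1_op_power:
  fixes \<alpha> \<tau> :: real
  assumes "0 < \<alpha>" "\<alpha> < 1" "0 < \<tau>" "m \<ge> 1"
  shows "((real (m - 1) * \<tau>) powr \<alpha>) ^ k / Gamma (1 + real k * \<alpha>)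
      \<le> L1_op \<alpha> \<tau> (\<lambda>j. ((real j * \<tau>) powr \<alpha>) ^ Suc k / Gamma (1 + real (Suc k) * \<alpha>)) m"
proof -
  define \<beta> where "\<beta> = real (Suc k) * \<alpha>"
  have \<beta>: "\<beta> > 0" "\<beta> - \<alpha> = real k * \<alpha>"
    using assms by (simp_all add: \<beta>_def distrib_right add_pos_nonneg)
  define S where "S = (\<Sum>j = 1..m. L1_coeff \<alpha> (m - j) * (real j powr \<beta> - real (j - 1) powr \<beta>))"
  \<comment> \<open>The node at which the Caputo derivative is dominated.\<close>
  define X where "X = (if \<beta> \<le> 1 then real m else real (m - 1))"
  have pos: "Gamma (2 - \<alpha>) > 0" "Gamma (1 + \<beta>) > 0" "Gamma (1 + real k * \<alpha>) > 0"
    using assms \<beta> by (auto intro!: Gamma_real_pos add_pos_nonneg)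
  have "X powr (\<beta> - \<alpha>) * (Gamma (2 - \<alpha>) * Gamma (1 + \<beta>) / Gamma (1 + \<beta> - \<alpha>)) \<le> S"
    unfolding X_def S_def using L1_sum_power_concave[of \<alpha> \<beta> m] L1_sum_power_convex[of \<alpha> \<beta> m] assms \<beta>
    by auto
  moreover have "1 + \<beta> - \<alpha> = 1 + real k * \<alpha>" using \<beta> by simp
  ultimately have S: "X powr (real k * \<alpha>) * (Gamma (2 - \<alpha>) * Gamma (1 + \<beta>) / Gamma (1 + real k * \<alpha>)) \<le> S"
    using \<beta> by simp
  have "((real (m - 1) * \<tau>) powr \<alpha>) ^ k \<le> (X * \<tau>) powr (real k * \<alpha>)"
  proof (cases "\<beta> \<le> 1")
    case True
    have "((real (m - 1) * \<tau>) powr \<alpha>) ^ k \<le> ((real m * \<tau>) powr \<alpha>) ^ k"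
      using assms by (intro power_mono powr_mono2 mult_right_mono) auto
    then show ?thesis using True assms by (simp add: X_def powr_power_nonneg)
  next
    case False
    then have "k \<ge> 1" using assms by (cases k) (auto simp: \<beta>_def)
    then show ?thesis using False by (simp add: X_def powr_power_nonneg)
  qed
  also have "\<dots> = X powr (real k * \<alpha>) * \<tau> powr (real k * \<alpha>)"
    by (simp add: powr_mult)
  finally have "((real (m - 1) * \<tau>) powr \<alpha>) ^ k / Gamma (1 + real k * \<alpha>)
      \<le> X powr (real k * \<alpha>) * \<tau> powr (real k * \<alpha>) / Gamma (1 + real k * \<alpha>)"
    using pos by (intro divide_right_mono) auto
  also have "\<dots> = \<tau> powr (real k * \<alpha>) / (Gamma (2 - \<alpha>) * Gamma (1 + \<beta>)) *
      (X powr (real k * \<alpha>) * (Gamma (2 - \<alpha>) * Gamma (1 + \<beta>) / Gamma (1 + real k * \<alpha>)))"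
    using pos by simp
  also have "\<dots> \<le> \<tau> powr (real k * \<alpha>) / (Gamma (2 - \<alpha>) * Gamma (1 + \<beta>)) * S"
    using pos by (intro mult_left_mono S) auto
  also have "\<tau> powr (real k * \<alpha>) = \<tau> powr (- \<alpha>) * \<tau> powr \<beta>"
    by (simp add: \<beta>(2)[symmetric] flip: powr_add)
  also have "\<tau> powr (- \<alpha>) * \<tau> powr \<beta> / (Gamma (2 - \<alpha>) * Gamma (1 + \<beta>)) * S =
      \<tau> powr (- \<alpha>) / Gamma (2 - \<alpha>) * (\<tau> powr \<beta> / Gamma (1 + \<beta>) * S)"
    by simp
  also have "\<tau> powr \<beta> / Gamma (1 + \<beta>) * S = (\<Sum>j = 1..m. L1_coeff \<alpha> (m - j) *
      (((real j * \<tau>) powr \<alpha>) ^ Suc k / Gamma (1 + \<beta>) - ((real (j - 1) * \<tau>) powr \<alpha>) ^ Suc k / Gamma (1 + \<beta>)))"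
  proof -
    have "((real j * \<tau>) powr \<alpha>) ^ Suc k = real j powr \<beta> * \<tau> powr \<beta>" for j
      by (subst powr_power_nonneg) (simp_all only: \<beta>_def powr_mult, simp)
    moreover have "\<tau> powr \<beta> / H * (L * (a - b)) = L * (a * \<tau> powr \<beta> / H - b * \<tau> powr \<beta> / H)"
      for H L a b :: real
      by (simp add: right_diff_distrib diff_divide_distrib mult_ac)
    ultimately show ?thesis
      by (simp only: S_def sum_distrib_left)
  qed
  finally show ?thesis by (simp add: L1_op_def \<beta>_def del: power_Suc)
qed

section \<open>The response to a constant source\<close>

text \<open>The solution of $D^\alpha u = \mu u + 1$ with $u(0) = 0$, which is $t^\alpha E_{\alpha,1+\alpha}(\mu t^\alpha)$
in terms of the two-parameter Mittag-Leffler function.\<close>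
definition ml_response :: "real \<Rightarrow> real \<Rightarrow> real \<Rightarrow> real" where
  "ml_response \<alpha> \<mu> t = (\<Sum>k. \<mu> ^ k * ((t powr \<alpha>) ^ Suc k / Gamma (1 + real (Suc k) * \<alpha>)))"

context
  fixes \<alpha> \<mu> :: real
  assumes \<alpha>: "0 < \<alpha>" "\<alpha> < 1" and \<mu>: "\<mu> \<ge> 0"
begin

text \<open>The upper bound compares the series with that of $E_\alpha$ term by term, by
superadditivity of $\ln \Gamma(1+x)$; it gives both summability and the final estimate.\<close>
lemma ml_response_term_bounds:
  "0 \<le> \<mu> ^ k * ((t powr \<alpha>) ^ Suc k / Gamma (1 + real (Suc k) * \<alpha>))"
  "\<mu> ^ k * ((t powr \<alpha>) ^ Suc k / Gamma (1 + real (Suc k) * \<alpha>))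
     \<le> t powr \<alpha> / Gamma (1 + \<alpha>) * ((\<mu> * t powr \<alpha>) ^ k / Gamma (1 + real k * \<alpha>))"
proof -
  have pos: "Gamma (1 + real (Suc k) * \<alpha>) > 0" "Gamma (1 + real k * \<alpha>) > 0" "Gamma (1 + \<alpha>) > 0"
    using \<alpha> by (auto intro!: Gamma_real_pos add_pos_nonneg)
  show "0 \<le> \<mu> ^ k * ((t powr \<alpha>) ^ Suc k / Gamma (1 + real (Suc k) * \<alpha>))"
    using pos \<mu> by (intro mult_nonneg_nonneg divide_nonneg_nonneg zero_le_power) auto
  have "Gamma (1 + \<alpha>) * Gamma (1 + real k * \<alpha>) \<le> Gamma (1 + real (Suc k) * \<alpha>)"
    using Gamma_superadditive[of \<alpha> "real k * \<alpha>"] \<alpha> by (simp add: algebra_simps)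
  then have "\<mu> ^ k * (t powr \<alpha>) ^ Suc k / Gamma (1 + real (Suc k) * \<alpha>)
      \<le> \<mu> ^ k * (t powr \<alpha>) ^ Suc k / (Gamma (1 + \<alpha>) * Gamma (1 + real k * \<alpha>))"
    using pos \<mu> by (intro divide_left_mono) auto
  then show "\<mu> ^ k * ((t powr \<alpha>) ^ Suc k / Gamma (1 + real (Suc k) * \<alpha>))
      \<le> t powr \<alpha> / Gamma (1 + \<alpha>) * ((\<mu> * t powr \<alpha>) ^ k / Gamma (1 + real k * \<alpha>))"
    by (simp add: power_mult_distrib mult_ac)
qed

lemma summable_ml_response:
  "summable (\<lambda>k. \<mu> ^ k * ((t powr \<alpha>) ^ Suc k / Gamma (1 + real (Suc k) * \<alpha>)))"
proof (rule summable_comparison_test')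
  show "summable (\<lambda>k. t powr \<alpha> / Gamma (1 + \<alpha>) * ((\<mu> * t powr \<alpha>) ^ k / Gamma (1 + real k * \<alpha>)))"
    by (intro summable_mult summable_mittag_leffler \<alpha>)
  show "norm (\<mu> ^ k * ((t powr \<alpha>) ^ Suc k / Gamma (1 + real (Suc k) * \<alpha>)))
      \<le> t powr \<alpha> / Gamma (1 + \<alpha>) * ((\<mu> * t powr \<alpha>) ^ k / Gamma (1 + real k * \<alpha>))" for k
    using ml_response_term_bounds[of k t] by (simp only: real_norm_def abs_of_nonneg)
qed

lemma ml_response_nonneg: "ml_response \<alpha> \<mu> t \<ge> 0"
  unfolding ml_response_def by (intro suminf_nonneg summable_ml_response ml_response_term_bounds)

lemma ml_response_le:
  "ml_response \<alpha> \<mu> t \<le> t powr \<alpha> / Gamma (1 + \<alpha>) * mittag_leffler \<alpha> (\<mu> * t powr \<alpha>)"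
  unfolding ml_response_def mittag_leffler_def
  by (subst suminf_mult[symmetric])
     (intro suminf_le summable_ml_response ml_response_term_bounds summable_mult summable_mittag_leffler \<alpha>)+

lemma mittag_leffler_eq_ml_response:
  "mittag_leffler \<alpha> (\<mu> * t powr \<alpha>) = 1 + \<mu> * ml_response \<alpha> \<mu> t"
proof -
  have "mittag_leffler \<alpha> (\<mu> * t powr \<alpha>) = 1 + (\<Sum>k. (\<mu> * t powr \<alpha>) ^ Suc k / Gamma (1 + real (Suc k) * \<alpha>))"
    unfolding mittag_leffler_def
    using suminf_split_head[OF summable_mittag_leffler[OF \<alpha>, of "\<mu> * t powr \<alpha>"]]
    by (simp del: power_Suc of_nat_Suc)
  also have "(\<lambda>k. (\<mu> * t powr \<alpha>) ^ Suc k / Gamma (1 + real (Suc k) * \<alpha>)) =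
      (\<lambda>k. \<mu> * (\<mu> ^ k * ((t powr \<alpha>) ^ Suc k / Gamma (1 + real (Suc k) * \<alpha>))))"
    by (simp add: power_mult_distrib mult_ac)
  also have "(\<Sum>k. \<mu> * (\<mu> ^ k * ((t powr \<alpha>) ^ Suc k / Gamma (1 + real (Suc k) * \<alpha>)))) = \<mu> * ml_response \<alpha> \<mu> t"
    unfolding ml_response_def by (rule suminf_mult[OF summable_ml_response])
  finally show ?thesis .
qed

text \<open>A discrete form of $D^\alpha u = \mu u + 1 = E_\alpha(\mu t^\alpha)$, with the lag of one step
inherited from the powers. L1 involves only finitely many nodes, so it commutes with the series.\<close>
lemma L1_op_ml_response:
  assumes "\<tau> > 0" "m \<ge> 1"
  shows "mittag_leffler \<alpha> (\<mu> * (real (m - 1) * \<tau>) powr \<alpha>) \<le> L1_op \<alpha> \<tau> (\<lambda>j. ml_response \<alpha> \<mu> (real j * \<tau>)) m"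
proof -
  let ?v = "\<lambda>k j. ((real j * \<tau>) powr \<alpha>) ^ Suc k / Gamma (1 + real (Suc k) * \<alpha>)"
  have "(\<lambda>k. \<mu> ^ k * ?v k j) sums ml_response \<alpha> \<mu> (real j * \<tau>)" for j
    unfolding ml_response_def by (rule summable_sums[OF summable_ml_response])
  then have upper: "(\<lambda>k. L1_op \<alpha> \<tau> (\<lambda>j. \<mu> ^ k * ?v k j) m) sums L1_op \<alpha> \<tau> (\<lambda>j. ml_response \<alpha> \<mu> (real j * \<tau>)) m"
    unfolding L1_op_def by (intro sums_mult sums_sum sums_diff)
  have lower: "(\<lambda>k. (\<mu> * (real (m - 1) * \<tau>) powr \<alpha>) ^ k / Gamma (1 + real k * \<alpha>)) sums
      mittag_leffler \<alpha> (\<mu> * (real (m - 1) * \<tau>) powr \<alpha>)"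
    unfolding mittag_leffler_def by (rule summable_sums[OF summable_mittag_leffler[OF \<alpha>]])
  have "(\<mu> * (real (m - 1) * \<tau>) powr \<alpha>) ^ k / Gamma (1 + real k * \<alpha>)
      \<le> L1_op \<alpha> \<tau> (\<lambda>j. \<mu> ^ k * ?v k j) m" for k
  proof -
    have "\<mu> ^ k * (((real (m - 1) * \<tau>) powr \<alpha>) ^ k / Gamma (1 + real k * \<alpha>)) \<le> \<mu> ^ k * L1_op \<alpha> \<tau> (?v k) m"
      using \<mu> \<alpha> assms by (intro mult_left_mono L1_op_power) auto
    also have "\<mu> ^ k * L1_op \<alpha> \<tau> (?v k) m = L1_op \<alpha> \<tau> (\<lambda>j. \<mu> ^ k * ?v k j) m"
      unfolding L1_op_def sum_distrib_left right_diff_distrib by (simp only: mult_ac)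
    finally show ?thesis by (simp only: power_mult_distrib times_divide_eq_right)
  qed
  then show ?thesis by (rule sums_le[OF _ lower upper])
qed

end

section \<open>The discrete fractional Gronwall inequality\<close>

text \<open>Here $u$ and $u'$ are the responses at the nodes $t_{m-1}$ and $t_m$, and the right-hand side is the
lower bound for L1 of the comparison function. By \<open>incr\<close>, replacing $u'$ by $u$ in the implicit term changes
it by at most half of $A = 4\lambda w + 2G$. This half, together with the source $G$, amounts to
$2\lambda w + 2G$; the remaining $\lambda(2w + Au)$ is covered by the rest of $A + 2\lambda A u$.\<close>
lemma supersolution_arith:
  fixes lam lam1 lam2 w G u u' :: real
  assumes "lam1 \<ge> 0" "lam2 \<ge> 0" "lam1 + lam2 \<le> lam" "w \<ge> 0" "G \<ge> 0" "u \<ge> 0"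
    and incr: "2 * lam * (u' - u) \<le> 1"
  shows "lam1 * (2 * w + (4 * lam * w + 2 * G) * u') + lam2 * (2 * w + (4 * lam * w + 2 * G) * u) + G
      \<le> (4 * lam * w + 2 * G) * (1 + 2 * lam * u)"
proof -
  define A where "A = 4 * lam * w + 2 * G"
  have A: "A \<ge> 0" using assms by (auto simp: A_def)
  have "lam1 * (u' - u) \<le> 1 / 2"
  proof (cases "u' \<le> u")
    case True
    then show ?thesis using mult_nonneg_nonpos[of lam1 "u' - u"] assms by simp
  next
    case False
    then have "lam1 * (u' - u) \<le> lam * (u' - u)" using assms by (intro mult_right_mono) auto
    then show ?thesis using incr by simp
  qed
  then have "A * (lam1 * (u' - u)) \<le> A * (1 / 2)" using A by (rule mult_left_mono)
  moreover have "(lam1 + lam2) * (2 * w + A * u) \<le> lam * (2 * w + A * u)"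
    using A assms by (intro mult_right_mono) auto
  moreover have "lam * A * u \<ge> 0" using A assms by auto
  ultimately show ?thesis
    unfolding A_def[symmetric] by (simp add: algebra_simps A_def)
qed

theorem lemma3p1:
  fixes \<alpha> T lam1 lam2 :: real
  assumes "0 < \<alpha>" and "\<alpha> < 1" and "T > 0"
    and "lam1 \<ge> 0" and "lam2 \<ge> 0"
  shows "\<exists>\<tau>_star > 0. \<forall>(N::nat) (\<tau>::real) (\<omega> :: nat \<Rightarrow> real) (g :: nat \<Rightarrow> real) (lam::real).
    N > 0 \<longrightarrow> \<tau> = T / real N \<longrightarrow> \<tau> \<le> \<tau>_star \<longrightarrow>
    lam = lam1 + lam2 / (2 - 2 powr (1 - \<alpha>)) \<longrightarrow>
    (\<forall>n. \<omega> n \<ge> 0) \<longrightarrow> (\<forall>n. g n \<ge> 0) \<longrightarrow>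
    (\<forall>n\<ge>1. L1_op \<alpha> \<tau> \<omega> n \<le> lam1 * \<omega> n + lam2 * \<omega> (n - 1) + g n) \<longrightarrow>
    (\<forall>n\<in>{1..N}.
       \<omega> n \<le> 2 * (\<omega> 0 + (real n * \<tau>) powr \<alpha> / Gamma (1 + \<alpha>) * Max (g ` {0..n}))
               * mittag_leffler \<alpha> (2 * lam * (real n * \<tau>) powr \<alpha>))"
proof -
  note \<alpha> = \<open>0 < \<alpha>\<close> \<open>\<alpha> < 1\<close>
  define lam where "lam = lam1 + lam2 / (2 - 2 powr (1 - \<alpha>))"
  \<comment> \<open>The denominator lies between 0 and 1, hence $\lambda \ge \lambda_1 + \lambda_2$.\<close>
  have "2 powr 0 \<le> (2::real) powr (1 - \<alpha>)" "2 powr (1 - \<alpha>) < (2::real) powr 1"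
    using \<alpha> by (intro powr_mono powr_less_mono; simp)+
  then have "lam2 \<le> lam2 / (2 - 2 powr (1 - \<alpha>))"
    using \<open>lam2 \<ge> 0\<close> by (simp add: pos_le_divide_eq mult_left_le)
  then have lam: "lam1 + lam2 \<le> lam" "lam \<ge> 0"
    using assms by (auto simp: lam_def)
  define E where "E t = mittag_leffler \<alpha> (2 * lam * t powr \<alpha>)" for t
  have "continuous_on {0..T} E"
    unfolding E_def using \<alpha>
    by (intro continuous_on_compose2[OF continuous_mittag_leffler[OF \<alpha>, of UNIV]]
        continuous_intros continuous_on_powr') auto
  then have "uniformly_continuous_on {0..T} E"
    by (simp add: compact_uniformly_continuous)
  then obtain d where d: "d > 0"
      "\<And>s t. s \<in> {0..T} \<Longrightarrow> t \<in> {0..T} \<Longrightarrow> dist t s < d \<Longrightarrow> dist (E t) (E s) < 1"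
    unfolding uniformly_continuous_on_def by (metis zero_less_one)
  \<comment> \<open>For $\tau \le c$ the diagonal entry of L1 is at least $\lambda_1 + 1$, as comparison requires.\<close>
  define c where "c = ((lam1 + 1) * Gamma (2 - \<alpha>)) powr (- 1 / \<alpha>)"
  have Gpos: "Gamma (2 - \<alpha>) > 0" using \<alpha> by auto
  then have base: "(lam1 + 1) * Gamma (2 - \<alpha>) > 0" using assms by (intro mult_pos_pos) auto
  then have "c > 0" unfolding c_def powr_gt_zero by linarith
  have c_powr: "c powr (- \<alpha>) = (lam1 + 1) * Gamma (2 - \<alpha>)"
    using \<alpha> base by (simp add: c_def powr_powr)
  show ?thesis
  proof (intro exI[of _ "min (d / 2) c"] conjI allI impI ballI)
    show "min (d / 2) c > 0" using d \<open>c > 0\<close> by simp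
  next
    fix N n :: nat and \<tau> lam' :: real and \<omega> g :: "nat \<Rightarrow> real"
    assume N: "N > 0" and \<tau>: "\<tau> = T / real N" "\<tau> \<le> min (d / 2) c"
      and lam': "lam' = lam1 + lam2 / (2 - 2 powr (1 - \<alpha>))"
      and \<omega>: "\<forall>n. \<omega> n \<ge> 0" and g: "\<forall>n. g n \<ge> 0"
      and sub: "\<forall>n\<ge>1. L1_op \<alpha> \<tau> \<omega> n \<le> lam1 * \<omega> n + lam2 * \<omega> (n - 1) + g n"
      and n: "n \<in> {1..N}"
    have "\<tau> > 0" using \<tau> N \<open>T > 0\<close> by simp
    define G where "G = Max (g ` {0..n})"
    have gG: "g m \<le> G" if "m \<le> n" for m using that by (auto simp: G_def)
    have "G \<ge> 0" using gG[of 0] g order_trans by blast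
    define U where "U m = ml_response \<alpha> (2 * lam) (real m * \<tau>)" for m
    define A where "A = 4 * lam * \<omega> 0 + 2 * G"
    define Y where "Y m = 2 * \<omega> 0 + A * U m" for m
    have EU: "E (real m * \<tau>) = 1 + 2 * lam * U m" for m
      unfolding E_def U_def using lam by (intro mittag_leffler_eq_ml_response \<alpha>) auto
    have U0: "U m \<ge> 0" for m
      unfolding U_def using lam by (intro ml_response_nonneg \<alpha>) auto
    have node: "real m * \<tau> \<in> {0..T}" if "m \<le> n" for m
    proof -
      have "real m * \<tau> \<le> real N * \<tau>" using that n \<open>\<tau> > 0\<close> by (intro mult_right_mono) auto
      also have "\<dots> = T" using \<tau>(1) N by simp
      finally show ?thesis using \<open>\<tau> > 0\<close> by simp
    qed
    \<comment> \<open>The source is replaced by its maximum $G$ up to the node $n$, so the comparison runs only up to $n$.\<close>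
    have "\<omega> n \<le> Y n"
    proof (rule L1_comparison[OF \<alpha>, where h = "\<lambda>_. G"])
      have "c powr (- \<alpha>) \<le> \<tau> powr (- \<alpha>)"
        using \<tau> \<alpha> \<open>\<tau> > 0\<close> by (intro powr_mono2') auto
      then show "lam1 < \<tau> powr (- \<alpha>) / Gamma (2 - \<alpha>)"
        using Gpos unfolding c_powr by (simp add: pos_less_divide_eq algebra_simps)
      have "A \<ge> 0" using lam \<omega> \<open>G \<ge> 0\<close> by (simp add: A_def)
      then show "\<omega> 0 \<le> Y 0" using U0[of 0] \<omega> by (simp add: Y_def add_increasing2)
    next
      fix m assume m: "1 \<le> m" "m \<le> n"
      show "L1_op \<alpha> \<tau> \<omega> m \<le> lam1 * \<omega> m + lam2 * \<omega> (m - 1) + G"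
        using sub m gG[of m] by (meson add_left_mono order_trans)
      \<comment> \<open>Adjacent nodes are at distance $\tau \le d/2 < d$.\<close>
      have "dist (real m * \<tau>) (real (m - 1) * \<tau>) < d"
      proof -
        have "real m * \<tau> - real (m - 1) * \<tau> = \<tau>" using m by (simp add: of_nat_diff algebra_simps)
        then show ?thesis using \<tau>(2) \<open>\<tau> > 0\<close> \<open>d > 0\<close> by (simp add: dist_real_def)
      qed
      then have "dist (E (real m * \<tau>)) (E (real (m - 1) * \<tau>)) < 1"
        using m by (intro d node) auto
      then have "2 * lam * (U m - U (m - 1)) \<le> 1"
        unfolding EU dist_real_def by (simp add: right_diff_distrib)
      then have "lam1 * Y m + lam2 * Y (m - 1) + G \<le> A * (1 + 2 * lam * U (m - 1))"
        unfolding Y_def A_def using assms lam \<omega> \<open>G \<ge> 0\<close> U0 by (intro supersolution_arith) auto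
      also have "\<dots> = A * E (real (m - 1) * \<tau>)" by (simp only: EU)
      also have "\<dots> \<le> A * L1_op \<alpha> \<tau> U m"
        unfolding E_def U_def using \<open>\<tau> > 0\<close> m lam \<omega> \<open>G \<ge> 0\<close>
        by (intro mult_left_mono L1_op_ml_response \<alpha>) (auto simp: A_def)
      also have "\<dots> = L1_op \<alpha> \<tau> Y m"
        unfolding Y_def by (rule L1_op_affine[symmetric])
      finally show "lam1 * Y m + lam2 * Y (m - 1) + G \<le> L1_op \<alpha> \<tau> Y m" .
    qed fact
    also have "Y n = 2 * (\<omega> 0 * E (real n * \<tau>) + G * U n)"
      unfolding Y_def A_def EU by (simp add: algebra_simps)
    also have "\<dots> \<le> 2 * (\<omega> 0 * E (real n * \<tau>) + G * ((real n * \<tau>) powr \<alpha> / Gamma (1 + \<alpha>) * E (real n * \<tau>)))"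
      unfolding E_def U_def using lam \<open>G \<ge> 0\<close>
      by (intro mult_left_mono add_left_mono ml_response_le \<alpha>) auto
    also have "\<dots> = 2 * (\<omega> 0 + (real n * \<tau>) powr \<alpha> / Gamma (1 + \<alpha>) * G) * E (real n * \<tau>)"
      by (simp add: algebra_simps)
    finally show "\<omega> n \<le> 2 * (\<omega> 0 + (real n * \<tau>) powr \<alpha> / Gamma (1 + \<alpha>) * Max (g ` {0..n}))
               * mittag_leffler \<alpha> (2 * lam' * (real n * \<tau>) powr \<alpha>)"
      by (simp only: E_def G_def lam_def lam')
  qed
qed

end
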